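(* Let $n\ge2$, let $w_1,\dots,w_n$ be positive integers with $\gcd(w_1,\dots,w_n)=1$, put $W=w_1+\cdots+w_n$, and let $\mathscr Z_w$ be the signed weighted datum with weights $w=(w_1,\dots,w_n)$. Then for distinct lattice points $A,B\in\mathbb Z^n$, $B$ is visible from $A$ if and only if $B$ is $p$-adically visible from $A$ for every prime $p$; that is, $$\mathcal V(\mathscr Z_w)=\bigcap_{p\text{ prime}}\mathcal V_p(\mathscr Z_w).$$ Moreover, the pair densities below exist, and $$\mathfrak d_{\mathrm{pair},p}(\mathscr Z_w)=1-\frac1{p^W}\quad\text{for every prime }p,\qquad \mathfrak d_{\mathrm{pair}}(\mathscr Z_w)=\prod_p\left(1-\frac1{p^W}\right)=\frac1{\zeta(W)}.$$
   Context: Signed weighted datum. Let $\Sigma=\{-1,0,1\}^n\setminus\{\mathbf 0\}$. Consider pairs $(\sigma,\alpha)$ with $\sigma\in\Sigma$ and $\alpha=(\alpha_1,\dots,\alpha_n)\in\mathbb Q_{\ge0}^n$ such that $\alpha_i=0\iff\sigma_i=0$. Two pairs $(\sigma,\alpha)$, $(\sigma,\beta)$ with the same $\sigma$ are equivalent if there is $c\in\mathbb R_{>0}$ with $\beta_i=c^{w_i}\alpha_i$ for every $i$. Let $I$ be the set of equivalence classes and choose one rational representative $(\sigma,\alpha)$ in each class. The branches of $\mathscr Z_w$ are the maps $$\phi_{\sigma,\alpha}:\mathbb R\to\mathbb R^n,\qquad \phi_{\sigma,\alpha}(t)=(\sigma_1\alpha_1t^{w_1},\dots,\sigma_n\alpha_nt^{w_n}),$$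 one for each class. Every $h\in\mathbb Z^n\setminus\{0\}$ equals $\phi_{\sigma,\alpha}(t)$ for a unique branch and a unique $t>0$. Visibility. For $h=\phi_{\sigma,\alpha}(t)\in\mathbb Z^n\setminus\{0\}$ with $t>0$: $h$ is globally visible if there is no real $s$ with $0<s<t$ and $\phi_{\sigma,\alpha}(s)\in\mathbb Z^n$; for a prime $p$, $h$ is $p$-adically visible if $v_p(h)\le v_p(\phi_{\sigma,\alpha}(s))$ for every real $s$ with $0<s<t$ and $\phi_{\sigma,\alpha}(s)\in\mathbb Z^n$, where $v_p(P)=\min_iv_p(P_i)$ and $v_p(0)=+\infty$. Pairs. For $A\ne B$ in $\mathbb Z^n$, $B$ is visible (resp. $p$-adically visible) from $A$ if $B-A$ is globally visible (resp. $p$-adically visible). $\mathcal V(\mathscr Z_w)$ (resp. $\mathcal V_p(\mathscr Z_w)$) is the set of pairs $(A,B)\in\mathbb Z^n\times\mathbb Z^n$ with $A\ne B$ such that $B$ is visible (resp. $p$-adically visible) from $A$. With $\Omega_X=\{1,\dots,\lfloor X\rfloor\}^n$, set $\mathfrak d_{\mathrm{pair}}(\mathscr Z_w)=\lim_{X\to\infty}\#(\mathcal V(\mathscr Z_w)\cap\Omega_X^2)/|\Omega_X|^2$ and $\mathfrak d_{\mathrm{pair},p}(\mathscr Z_w)=\lim_{X\to\infty}\#(\mathcal V_p(\mathscr Z_w)\cap\Omega_X^2)/|\Omega_X|^2$. $\zeta$ is the Riemann zeta function. *)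

theory Defs
  imports "HOL-Analysis.Analysis" "HOL-Computational_Algebra.Primes"
begin

text \<open>The space \<open>\<int>\<^sup>n\<close> is the type \<open>int ^ 'n\<close> with \<open>n = CARD('n)\<close>; it is embedded into \<open>\<real>\<^sup>n\<close> explicitly.\<close>

definition real_vec :: "int ^ 'n \<Rightarrow> real ^ 'n" where
  "real_vec P = (\<chi> i. of_int (P $ i))"

section \<open>The signed weighted datum\<close>

definition signed_data :: "((int ^ 'n) \<times> (rat ^ 'n)) set" where
  "signed_data = {(\<sigma>, \<alpha>). (\<forall>i. \<sigma> $ i \<in> {-1, 0, 1}) \<and> \<sigma> \<noteq> 0 \<and>
     (\<forall>i. 0 \<le> \<alpha> $ i) \<and> (\<forall>i. \<alpha> $ i = 0 \<longleftrightarrow> \<sigma> $ i = 0)}"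

definition weighted_equiv ::
  "nat ^ 'n \<Rightarrow> (((int ^ 'n) \<times> (rat ^ 'n)) \<times> ((int ^ 'n) \<times> (rat ^ 'n))) set" where
  "weighted_equiv w = {((\<sigma>, \<alpha>), (\<tau>, \<beta>)). (\<sigma>, \<alpha>) \<in> signed_data \<and> (\<tau>, \<beta>) \<in> signed_data \<and> \<sigma> = \<tau> \<and>
     (\<exists>c::real. 0 < c \<and> (\<forall>i. of_rat (\<beta> $ i) = c ^ (w $ i) * of_rat (\<alpha> $ i)))}"

definition branch_classes :: "nat ^ 'n \<Rightarrow> ((int ^ 'n) \<times> (rat ^ 'n)) set set" where
  "branch_classes w = signed_data // weighted_equiv w"

definition representative_choice ::
  "nat ^ 'n \<Rightarrow> (((int ^ 'n) \<times> (rat ^ 'n)) set \<Rightarrow> (int ^ 'n) \<times> (rat ^ 'n)) \<Rightarrow> bool" where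
  "representative_choice w rep \<longleftrightarrow> (\<forall>C \<in> branch_classes w. rep C \<in> C)"

definition branch :: "nat ^ 'n \<Rightarrow> (int ^ 'n) \<times> (rat ^ 'n) \<Rightarrow> real \<Rightarrow> real ^ 'n" where
  "branch w = (\<lambda>(\<sigma>, \<alpha>) t. \<chi> i. of_int (\<sigma> $ i) * of_rat (\<alpha> $ i) * t ^ (w $ i))"

lemma equiv_weighted_equiv: "equiv signed_data (weighted_equiv w)"
proof (rule equivI)
  show "weighted_equiv w \<subseteq> signed_data \<times> signed_data"
    by (auto simp: weighted_equiv_def)
  show "refl_on signed_data (weighted_equiv w)"
    by (auto simp: refl_on_def weighted_equiv_def intro!: exI[of _ 1])
  show "sym (weighted_equiv w)"
  proof (rule symI, clarify)
    fix \<sigma> \<tau> :: "int ^ 'a" and \<alpha> \<beta> :: "rat ^ 'a"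
    assume a: "((\<sigma>, \<alpha>), \<tau>, \<beta>) \<in> weighted_equiv w"
    then obtain c :: real where "0 < c" "\<forall>i. of_rat (\<beta> $ i) = c ^ (w $ i) * of_rat (\<alpha> $ i)"
      by (auto simp: weighted_equiv_def)
    then have "0 < 1 / c \<and> (\<forall>i. of_rat (\<alpha> $ i) = (1 / c) ^ (w $ i) * of_rat (\<beta> $ i))"
      by (simp add: power_divide)
    with a show "((\<tau>, \<beta>), \<sigma>, \<alpha>) \<in> weighted_equiv w"
      unfolding weighted_equiv_def by blast
  qed
  show "trans (weighted_equiv w)"
  proof (rule transI, clarify)
    fix \<sigma> \<tau> \<rho> :: "int ^ 'a" and \<alpha> \<beta> \<gamma> :: "rat ^ 'a"
    assume a: "((\<sigma>, \<alpha>), \<tau>, \<beta>) \<in> weighted_equiv w" and b: "((\<tau>, \<beta>), \<rho>, \<gamma>) \<in> weighted_equiv w"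
    from a obtain c :: real where c: "0 < c" "\<forall>i. of_rat (\<beta> $ i) = c ^ (w $ i) * of_rat (\<alpha> $ i)"
      by (auto simp: weighted_equiv_def)
    from b obtain d :: real where d: "0 < d" "\<forall>i. of_rat (\<gamma> $ i) = d ^ (w $ i) * of_rat (\<beta> $ i)"
      by (auto simp: weighted_equiv_def)
    from c d have "0 < d * c \<and> (\<forall>i. of_rat (\<gamma> $ i) = (d * c) ^ (w $ i) * of_rat (\<alpha> $ i))"
      by (simp add: power_mult_distrib)
    with a b show "((\<sigma>, \<alpha>), \<rho>, \<gamma>) \<in> weighted_equiv w"
      unfolding weighted_equiv_def by blast
  qed
qed

text \<open>Every nonzero lattice point lies on a unique branch, for a unique positive parameter.
  The existential quantifiers over branch and parameter in the two notions of
  visibility below are therefore unambiguous.\<close>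

lemma lattice_point_unique_branch:
  fixes w :: "nat ^ 'n" and h :: "int ^ 'n"
  assumes rep: "representative_choice w rep" and w: "\<forall>i. 0 < w $ i" and h: "h \<noteq> 0"
  shows "\<exists>!(C, t). C \<in> branch_classes w \<and> 0 < t \<and> real_vec h = branch w (rep C) t"
proof -
  define \<sigma> :: "int ^ 'n" where "\<sigma> = (\<chi> i. sgn (h $ i))"
  define \<alpha> :: "rat ^ 'n" where "\<alpha> = (\<chi> i. of_int \<bar>h $ i\<bar>)"
  define C where "C = weighted_equiv w `` {(\<sigma>, \<alpha>)}"
  have in_data: "(\<sigma>, \<alpha>) \<in> signed_data"
    using h by (auto simp: signed_data_def \<sigma>_def \<alpha>_def vec_eq_iff sgn_if)
  have C: "C \<in> branch_classes w"
    unfolding C_def branch_classes_def by (rule quotientI[OF in_data])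
  have prod_h: "of_int (sgn (h $ i)) * \<bar>real_of_int (h $ i)\<bar> = of_int (h $ i)" for i
    by (auto simp: sgn_if)
  have of_rat_\<alpha>: "of_rat (\<alpha> $ i) = \<bar>real_of_int (h $ i)\<bar>" for i
    by (simp add: \<alpha>_def del: of_int_abs)
  obtain \<tau> \<beta> where r: "rep C = (\<tau>, \<beta>)" by (cases "rep C")
  have rC: "((\<sigma>, \<alpha>), (\<tau>, \<beta>)) \<in> weighted_equiv w"
    using rep C r unfolding representative_choice_def C_def by force
  then obtain c :: real where c: "0 < c" "\<tau> = \<sigma>"
    "\<And>i. of_rat (\<beta> $ i) = c ^ (w $ i) * of_rat (\<alpha> $ i)"
    by (auto simp: weighted_equiv_def)
  have ex: "real_vec h = branch w (rep C) (1 / c)"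
    using c by (simp add: r real_vec_def branch_def vec_eq_iff \<sigma>_def of_rat_\<alpha> prod_h power_divide)
  have same: "D = C \<and> t = 1 / c" if D: "D \<in> branch_classes w" and t: "0 < t"
    and e: "real_vec h = branch w (rep D) t" for D t
  proof -
    obtain \<rho> \<gamma> where q: "rep D = (\<rho>, \<gamma>)" by (cases "rep D")
    have qD: "(\<rho>, \<gamma>) \<in> D" using rep D q unfolding representative_choice_def by force
    have qd: "(\<rho>, \<gamma>) \<in> signed_data"
      using qD D equiv_weighted_equiv in_quotient_imp_subset
      unfolding branch_classes_def by blast
    have ei: "of_int (h $ i) = of_int (\<rho> $ i) * of_rat (\<gamma> $ i) * t ^ (w $ i)" for i
      using e by (simp add: q real_vec_def branch_def vec_eq_iff)
    have rv: "\<rho> $ i \<in> {-1, 0, 1}" "0 \<le> \<gamma> $ i" "\<gamma> $ i = 0 \<longleftrightarrow> \<rho> $ i = 0" for i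
      using qd by (auto simp: signed_data_def)
    have s: "\<rho> $ i = \<sigma> $ i \<and> \<bar>real_of_int (h $ i)\<bar> = t ^ (w $ i) * of_rat (\<gamma> $ i)" for i
    proof -
      have tp: "0 < t ^ (w $ i)" using t by simp
      consider "\<rho> $ i = 0" | "\<rho> $ i = 1" "0 < \<gamma> $ i" | "\<rho> $ i = -1" "0 < \<gamma> $ i"
        using rv[of i] by force
      then show ?thesis
      proof cases
        case 1
        with ei[of i] rv(3)[of i] show ?thesis by (simp add: \<sigma>_def)
      next
        case 2
        then have p: "0 < of_rat (\<gamma> $ i) * t ^ (w $ i)" using tp by simp
        have "real_of_int (h $ i) = of_rat (\<gamma> $ i) * t ^ (w $ i)" using ei[of i] 2 by simp
        with p show ?thesis using 2 by (simp add: \<sigma>_def mult.commute)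
      next
        case 3
        then have p: "0 < of_rat (\<gamma> $ i) * t ^ (w $ i)" using tp by simp
        have "real_of_int (h $ i) = - (of_rat (\<gamma> $ i) * t ^ (w $ i))" using ei[of i] 3 by simp
        with p show ?thesis using 3 by (simp add: \<sigma>_def mult.commute)
      qed
    qed
    have "\<rho> = \<sigma>" using s by (simp add: vec_eq_iff)
    moreover have "of_rat (\<alpha> $ i) = t ^ (w $ i) * of_rat (\<gamma> $ i)" for i
      using s[of i] by (simp add: of_rat_\<alpha>)
    ultimately have "((\<rho>, \<gamma>), (\<sigma>, \<alpha>)) \<in> weighted_equiv w"
      using t qd in_data unfolding weighted_equiv_def by blast
    moreover have "(\<sigma>, \<alpha>) \<in> C"
      unfolding C_def using equiv_weighted_equiv in_data by (rule equiv_class_self)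
    ultimately have DC: "D = C"
      using quotient_eqI[OF equiv_weighted_equiv _ _ qD] D C
      unfolding branch_classes_def by blast
    obtain j where j: "h $ j \<noteq> 0" using h by (auto simp: vec_eq_iff)
    have "branch w (rep C) t $ j = branch w (rep C) (1 / c) $ j" using e ex DC by simp
    moreover have "of_int (\<tau> $ j) * real_of_rat (\<beta> $ j) \<noteq> 0"
      using c j by (simp add: \<sigma>_def of_rat_\<alpha> sgn_if)
    ultimately have "t ^ (w $ j) = (1 / c) ^ (w $ j)"
      by (simp add: branch_def r)
    then have "t = 1 / c"
      using t c(1) w by (metis less_eq_real_def power_eq_imp_eq_base zero_less_divide_1_iff)
    with DC show ?thesis by simp
  qed
  show ?thesis
    using C ex c(1) same by (intro ex1I[of _ "(C, 1 / c)"]) auto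
qed

section \<open>Visibility\<close>

text \<open>\<open>multiplicity p 0 = 0\<close> in the library, whereas \<open>v\<^sub>p(0) = \<infinity>\<close>.\<close>

definition val :: "nat \<Rightarrow> int \<Rightarrow> enat" where
  "val p x = (if x = 0 then \<infinity> else enat (multiplicity (int p) x))"

definition vec_val :: "nat \<Rightarrow> int ^ 'n \<Rightarrow> enat" where
  "vec_val p P = (MIN i. val p (P $ i))"

definition globally_visible ::
  "nat ^ 'n \<Rightarrow> (((int ^ 'n) \<times> (rat ^ 'n)) set \<Rightarrow> (int ^ 'n) \<times> (rat ^ 'n)) \<Rightarrow> int ^ 'n \<Rightarrow> bool" where
  "globally_visible w rep h \<longleftrightarrow>
     (\<exists>C \<in> branch_classes w. \<exists>t>0. real_vec h = branch w (rep C) t \<and>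
        \<not> (\<exists>s. 0 < s \<and> s < t \<and> branch w (rep C) s \<in> range real_vec))"

definition p_visible ::
  "nat ^ 'n \<Rightarrow> (((int ^ 'n) \<times> (rat ^ 'n)) set \<Rightarrow> (int ^ 'n) \<times> (rat ^ 'n)) \<Rightarrow> nat \<Rightarrow> int ^ 'n \<Rightarrow> bool" where
  "p_visible w rep p h \<longleftrightarrow>
     (\<exists>C \<in> branch_classes w. \<exists>t>0. real_vec h = branch w (rep C) t \<and>
        (\<forall>s P. 0 < s \<and> s < t \<and> branch w (rep C) s = real_vec P \<longrightarrow> vec_val p h \<le> vec_val p P))"

definition visible_pairs ::
  "nat ^ 'n \<Rightarrow> (((int ^ 'n) \<times> (rat ^ 'n)) set \<Rightarrow> (int ^ 'n) \<times> (rat ^ 'n)) \<Rightarrow> ((int ^ 'n) \<times> (int ^ 'n)) set" where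
  "visible_pairs w rep = {(A, B). A \<noteq> B \<and> globally_visible w rep (B - A)}"

definition p_visible_pairs ::
  "nat ^ 'n \<Rightarrow> (((int ^ 'n) \<times> (rat ^ 'n)) set \<Rightarrow> (int ^ 'n) \<times> (rat ^ 'n)) \<Rightarrow> nat \<Rightarrow> ((int ^ 'n) \<times> (int ^ 'n)) set" where
  "p_visible_pairs w rep p = {(A, B). A \<noteq> B \<and> p_visible w rep p (B - A)}"

section \<open>Pair density and zeta values\<close>

definition lattice_box :: "real \<Rightarrow> (int ^ 'n) set" where
  "lattice_box X = {A. \<forall>i. A $ i \<in> {1..\<lfloor>X\<rfloor>}}"

definition has_pair_density :: "((int ^ 'n) \<times> (int ^ 'n)) set \<Rightarrow> real \<Rightarrow> bool" where
  "has_pair_density V d \<longleftrightarrow>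
     ((\<lambda>X::real. real (card (V \<inter> lattice_box X \<times> lattice_box X)) / (real (card (lattice_box X :: (int ^ 'n) set)))\<^sup>2) \<longlongrightarrow> d) at_top"

text \<open>The Riemann zeta function, by its Dirichlet series; meaningful for \<open>s > 1\<close> only.\<close>

definition zeta :: "real \<Rightarrow> real" where
  "zeta s = (\<Sum>k. 1 / real (Suc k) powr s)"

end

theory Submission
  imports Defs
begin

text \<open>Write \<open>h = B - A\<close>. The points of the branch of \<open>h\<close> that come before \<open>h\<close> are the vectors with entries
\<open>l\<^bsup>w\<^sub>i\<^esup> h\<^sub>i\<close>, where \<open>0 < l < 1\<close>. If such a vector \<open>P\<close> is integral and \<open>g\<close> is the gcd of the weights on the
support of \<open>h\<close>, then \<open>l\<^bsup>g\<^esup>\<close> is a rational number \<open>a / b\<close> in lowest terms with \<open>b > 1\<close>. With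
\<open>e\<^sub>i = w\<^sub>i / g\<close>, integrality forces \<open>b\<^bsup>e\<^sub>i\<^esup>\<close> to divide \<open>h\<^sub>i\<close> for every \<open>i\<close>. Conversely a prime \<open>p\<close> with
\<open>p\<^bsup>e\<^sub>i\<^esup>\<close> dividing \<open>h\<^sub>i\<close> for every \<open>i\<close> gives the earlier lattice point \<open>h\<^sub>i / p\<^bsup>e\<^sub>i\<^esup>\<close>, whose \<open>p\<close>-adic valuation is
strictly smaller than that of \<open>h\<close>; and an earlier point of smaller \<open>p\<close>-adic valuation must come from
a denominator \<open>b\<close> divisible by \<open>p\<close>. Hence \<open>h\<close> is \<open>p\<close>-adically visible iff the \<open>p\<^bsup>e\<^sub>i\<^esup>\<close> do not all divide
the \<open>h\<^sub>i\<close> (\<open>p_visible_iff\<close>), and globally visible iff this is so for every prime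
(\<open>globally_visible_iff\<close>), which is the local-global principle.

For the densities, pairs with \<open>A\<^sub>i = B\<^sub>i\<close> for some \<open>i\<close> have density zero, and for the others \<open>g = 1\<close>, so
that \<open>e = w\<close>. The condition that \<open>d\<^bsup>w\<^sub>i\<^esup>\<close> divides \<open>B\<^sub>i - A\<^sub>i\<close> for every \<open>i\<close> has density \<open>1 / d\<^bsup>W\<^esup>\<close>, and removing
finitely many primes one at a time yields the product of the factors \<open>1 - 1 / p\<^bsup>W\<^esup>\<close>
(\<open>has_pair_density_sieved_pairs\<close>). The primes beyond \<open>M\<close> matter little: off the diagonal there are at
most \<open>2 N\<^sup>2 / m\<close> pairs in \<open>{1..N}\<^sup>2\<close> congruent modulo \<open>m\<close>, without a rounding term, so the pairs without a
coincidence that are affected by some \<open>d > M\<close> have proportion at most \<open>2\<^sup>n / M\<close> in every box, as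
\<open>W \<ge> n \<ge> 2\<close> (\<open>pair_proportion_large_divisor_le\<close>).
Letting \<open>M\<close> grow gives the full Euler product. The same sieve, applied to the positive integers with
mass \<open>1 / k\<^bsup>W\<^esup>\<close> at \<open>k\<close>, identifies that product with \<open>1 / \<zeta>(W)\<close> (\<open>euler_product_bounds\<close>).\<close>

section \<open>Lattice points below a given one on its branch\<close>

text \<open>The exponents \<open>k\<close> with \<open>x\<^bsup>k\<^esup>\<close> rational are closed under gcd, by Bezout.\<close>
lemma power_gcd_in_Rats:
  fixes x :: real
  assumes "0 < x" "x ^ a \<in> \<rat>" "x ^ b \<in> \<rat>"
  shows "x ^ gcd a b \<in> \<rat>"
proof (cases "a = 0")
  case False
  then obtain u v where "a * u = b * v + gcd a b"
    using bezout_nat by blast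
  then have "(x ^ a) ^ u = (x ^ b) ^ v * x ^ gcd a b"
    by (simp flip: power_mult power_add)
  then have "x ^ gcd a b = (x ^ a) ^ u / (x ^ b) ^ v"
    using assms(1) by (simp add: field_simps)
  then show ?thesis
    using assms by simp
qed (use assms in simp)

lemma power_Gcd_in_Rats:
  fixes x :: real
  assumes "finite K" "0 < x" "\<And>k. k \<in> K \<Longrightarrow> x ^ k \<in> \<rat>"
  shows "x ^ Gcd K \<in> \<rat>"
  using assms(1,3) by (induction K rule: finite_induct) (auto intro: power_gcd_in_Rats assms(2))

text \<open>The points before \<open>h\<close> on its branch, described by the ratio \<open>l\<close> of the two parameters. This form does
not mention the chosen representative of the branch.\<close>
definition precedes :: "nat ^ 'n \<Rightarrow> int ^ 'n \<Rightarrow> int ^ 'n \<Rightarrow> bool" where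
  "precedes w P h \<longleftrightarrow>
     (\<exists>l::real. 0 < l \<and> l < 1 \<and> (\<forall>i. of_int (P $ i) = l ^ (w $ i) * of_int (h $ i)))"

lemma branch_scale: "branch w r (l * t) $ i = l ^ (w $ i) * branch w r t $ i"
  by (cases r) (simp add: branch_def power_mult_distrib)

lemma earlier_on_branch_iff_precedes:
  assumes "0 < t" "real_vec h = branch w r t"
  shows "(\<exists>s. 0 < s \<and> s < t \<and> branch w r s = real_vec P) \<longleftrightarrow> precedes w P h"
proof -
  have h: "branch w r t $ i = of_int (h $ i)" for i
    using assms(2) by (metis real_vec_def vec_lambda_beta)
  have eq: "branch w r (l * t) = real_vec P \<longleftrightarrow>
      (\<forall>i. of_int (P $ i) = l ^ (w $ i) * (of_int (h $ i) :: real))" for l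
    by (auto simp: vec_eq_iff branch_scale h real_vec_def)
  show ?thesis
  proof
    assume "\<exists>s. 0 < s \<and> s < t \<and> branch w r s = real_vec P"
    then obtain s where s: "0 < s" "s < t" "branch w r s = real_vec P" by blast
    have "s = (s / t) * t" "0 < s / t" "s / t < 1" using s assms(1) by auto
    then show "precedes w P h"
      unfolding precedes_def using eq s(3) by metis
  next
    assume "precedes w P h"
    then obtain l where "0 < l" "l < 1" "branch w r (l * t) = real_vec P"
      unfolding precedes_def using eq by blast
    then show "\<exists>s. 0 < s \<and> s < t \<and> branch w r s = real_vec P"
      using assms(1) by (intro exI[of _ "l * t"]) auto
  qed
qed

context
  fixes w :: "nat ^ 'n" and rep and h :: "int ^ 'n"
  assumes rep: "representative_choice w rep" and w: "\<forall>i. 0 < w $ i" and h: "h \<noteq> 0"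
begin

lemma point_on_branch:
  obtains C t where "C \<in> branch_classes w" "0 < t" "real_vec h = branch w (rep C) t"
  using lattice_point_unique_branch[OF rep w h] by blast

lemma globally_visible_iff_not_precedes:
  "globally_visible w rep h \<longleftrightarrow> (\<nexists>P. precedes w P h)"
proof -
  have *: "(\<exists>s. 0 < s \<and> s < t \<and> branch w (rep C) s \<in> range real_vec) \<longleftrightarrow> (\<exists>P. precedes w P h)"
    if "0 < t" "real_vec h = branch w (rep C) t" for C t
    unfolding earlier_on_branch_iff_precedes[OF that, symmetric] by (auto simp: image_iff)
  show ?thesis
    unfolding globally_visible_def using * by (metis point_on_branch)
qed

lemma p_visible_iff_precedes:
  "p_visible w rep p h \<longleftrightarrow> (\<forall>P. precedes w P h \<longrightarrow> vec_val p h \<le> vec_val p P)"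
proof -
  have *: "(\<forall>s P. 0 < s \<and> s < t \<and> branch w (rep C) s = real_vec P \<longrightarrow> vec_val p h \<le> vec_val p P) \<longleftrightarrow>
      (\<forall>P. precedes w P h \<longrightarrow> vec_val p h \<le> vec_val p P)"
    if "0 < t" "real_vec h = branch w (rep C) t" for C t
    unfolding earlier_on_branch_iff_precedes[OF that, symmetric] by blast
  obtain C t where "C \<in> branch_classes w" "0 < t" "real_vec h = branch w (rep C) t"
    by (rule point_on_branch)
  then show ?thesis
    unfolding p_visible_def using * by fast
qed

end

section \<open>Visibility as a divisibility condition\<close>

definition weighted_dvd :: "nat ^ 'n \<Rightarrow> nat \<Rightarrow> int ^ 'n \<Rightarrow> bool" where
  "weighted_dvd w d h \<longleftrightarrow> (\<forall>i. int d ^ (w $ i) dvd h $ i)"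

text \<open>Coordinates where \<open>h\<close> vanishes put no constraint on the parameter ratio, so the weights that count are
those on the support of \<open>h\<close>, and these may have a common factor even when all weights together do not.\<close>
definition support_gcd :: "nat ^ 'n \<Rightarrow> int ^ 'n \<Rightarrow> nat" where
  "support_gcd w h = Gcd (($) w ` {i. h $ i \<noteq> 0})"

definition reduced_weight :: "nat ^ 'n \<Rightarrow> int ^ 'n \<Rightarrow> nat ^ 'n" where
  "reduced_weight w h = (\<chi> i. w $ i div support_gcd w h)"

lemma support_gcd_mult_reduced_weight:
  assumes "h $ i \<noteq> 0"
  shows "support_gcd w h * reduced_weight w h $ i = w $ i"
  using assms by (simp add: support_gcd_def reduced_weight_def Gcd_dvd)

text \<open>If \<open>l\<close> is the parameter ratio, then \<open>l\<^bsup>w\<^sub>i\<^esup> = P\<^sub>i / h\<^sub>i\<close> is rational on the support of \<open>h\<close>, hence so is \<open>l\<close> to the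
gcd of these weights; \<open>a / b\<close> is that power in lowest terms, and \<open>b > 1\<close> because \<open>0 < l < 1\<close>.\<close>
lemma precedes_imp_ratio:
  assumes w: "\<forall>i. 0 < w $ i" and h: "h \<noteq> 0" and "precedes w P h"
  obtains a b :: nat where "coprime a b" "1 < b"
    "\<And>i. int b ^ (reduced_weight w h $ i) * P $ i = int a ^ (reduced_weight w h $ i) * h $ i"
proof -
  obtain l :: real where l: "0 < l" "l < 1" "\<And>i. of_int (P $ i) = l ^ (w $ i) * of_int (h $ i)"
    using assms(3) unfolding precedes_def by blast
  let ?g = "support_gcd w h" and ?e = "reduced_weight w h"
  have "l ^ (w $ i) \<in> \<rat>" if "h $ i \<noteq> 0" for i
  proof -
    have "l ^ (w $ i) = of_int (P $ i) / of_int (h $ i)" using l(3)[of i] that by simp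
    then show ?thesis by simp
  qed
  then have "l ^ ?g \<in> \<rat>"
    unfolding support_gcd_def by (intro power_Gcd_in_Rats l(1)) auto
  then obtain a b :: nat where ab: "b \<noteq> 0" "\<bar>l ^ ?g\<bar> = real a / real b" "coprime a b"
    by (rule Rats_abs_nat_div_natE)
  have lg: "l ^ ?g = real a / real b" using ab(2) l(1) by simp
  obtain j where j: "h $ j \<noteq> 0" using h by (auto simp: vec_eq_iff)
  have "?g > 0"
    using support_gcd_mult_reduced_weight[OF j, of w] w by (metis gr0I mult_0 less_irrefl)
  then have "l ^ ?g < 1" using l by (simp add: power_less_one_iff)
  then have "a < b" using lg ab(1) by (simp add: field_simps)
  moreover have "a > 0" using lg l(1) by (metis divide_eq_0_iff gr0I less_irrefl of_nat_0 zero_less_power)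
  ultimately have "1 < b" by linarith
  moreover have "int b ^ (?e $ i) * P $ i = int a ^ (?e $ i) * h $ i" for i
  proof (cases "h $ i = 0")
    case True
    then show ?thesis using l(3)[of i] by simp
  next
    case False
    have "l ^ (w $ i) = (real a / real b) ^ (?e $ i)"
      by (metis False lg power_mult support_gcd_mult_reduced_weight)
    with l(3)[of i] have "real b ^ (?e $ i) * of_int (P $ i) = real a ^ (?e $ i) * of_int (h $ i)"
      using ab(1) by (simp add: field_simps)
    then have "real_of_int (int b ^ (?e $ i) * P $ i) = real_of_int (int a ^ (?e $ i) * h $ i)"
      by simp
    then show ?thesis by (simp only: of_int_eq_iff)
  qed
  ultimately show ?thesis using that ab(3) by blast
qed

lemma weighted_dvd_of_ratio:
  assumes "coprime a b" "int p dvd int b"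
    "\<And>i. int b ^ (e $ i) * P $ i = int a ^ (e $ i) * h $ i"
  shows "weighted_dvd e p h"
  unfolding weighted_dvd_def
proof
  fix i
  have "int b ^ (e $ i) dvd int a ^ (e $ i) * h $ i"
    by (metis assms(3) dvd_triv_left)
  then have "int b ^ (e $ i) dvd h $ i"
    using assms(1) by (simp add: coprime_commute coprime_dvd_mult_right_iff)
  then show "int p ^ (e $ i) dvd h $ i"
    using assms(2) dvd_power_same dvd_trans by blast
qed

text \<open>The parameter ratio \<open>l\<close> with \<open>l\<^bsup>g\<^esup> = 1 / p\<close>, where \<open>g\<close> is the gcd on the support, divides each \<open>h\<^sub>i\<close> by \<open>p\<^bsup>e\<^sub>i\<^esup>\<close>.
The valuation drops because the minimal valuation of \<open>h\<close> is attained on the support, where \<open>e\<^sub>i > 0\<close>.\<close>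
lemma weighted_dvd_imp_precedes:
  assumes p: "prime p" and w: "\<forall>i. 0 < w $ i" and h: "h \<noteq> 0"
    and dvd: "weighted_dvd (reduced_weight w h) p h"
  obtains P where "precedes w P h" "vec_val p P < vec_val p h"
proof -
  let ?g = "support_gcd w h" and ?e = "reduced_weight w h"
  define P :: "int ^ _" where "P = (\<chi> i. h $ i div int p ^ (?e $ i))"
  have P: "h $ i = int p ^ (?e $ i) * P $ i" for i
    using dvd by (simp add: P_def weighted_dvd_def)
  have pos: "?g > 0 \<and> ?e $ i > 0" if "h $ i \<noteq> 0" for i
    using support_gcd_mult_reduced_weight[OF that, of w] w by (metis gr0I mult_0 mult_0_right less_irrefl)
  obtain j where j: "h $ j \<noteq> 0" using h by (auto simp: vec_eq_iff)
  have p1: "real p > 1" using p prime_gt_1_nat by force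
  define l where "l = root ?g (1 / real p)"
  have lg: "l ^ ?g = 1 / real p"
    unfolding l_def using pos[OF j] p1 by (intro real_root_pow_pos2) auto
  have "0 < l" "l < 1"
    using pos[OF j] p1 unfolding l_def by auto
  moreover have "of_int (P $ i) = l ^ (w $ i) * of_int (h $ i)" for i
  proof (cases "h $ i = 0")
    case True
    then show ?thesis by (simp add: P_def)
  next
    case False
    have "l ^ (w $ i) = (1 / real p) ^ (?e $ i)"
      by (metis False lg power_mult support_gcd_mult_reduced_weight)
    then show ?thesis using P[of i] p1 by (simp add: field_simps)
  qed
  ultimately have "precedes w P h" unfolding precedes_def by blast
  moreover have "vec_val p P < vec_val p h"
  proof -
    have "vec_val p h \<in> range (\<lambda>i. val p (h $ i))"
      unfolding vec_val_def by (intro Min_in) auto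
    then obtain k where k: "vec_val p h = val p (h $ k)" by blast
    have "vec_val p h \<le> val p (h $ j)" unfolding vec_val_def by (intro Min_le) auto
    then have hk: "h $ k \<noteq> 0" using j k by (auto simp: val_def)
    then have Pk: "P $ k \<noteq> 0" using P[of k] by auto
    have "multiplicity (int p) (h $ k) = ?e $ k + multiplicity (int p) (P $ k)"
      unfolding P[of k] using Pk p
      by (subst prime_elem_multiplicity_mult_distrib) auto
    then have "val p (P $ k) < val p (h $ k)"
      using hk Pk pos[OF hk] by (simp add: val_def)
    then show ?thesis unfolding k unfolding vec_val_def by (subst Min_less_iff) auto
  qed
  ultimately show ?thesis using that by blast
qed

text \<open>An earlier point \<open>P\<close> of smaller valuation has an entry \<open>P\<^sub>i\<close> of smaller valuation than \<open>h\<^sub>i\<close>. Since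
\<open>b\<^bsup>e\<^sub>i\<^esup> P\<^sub>i = a\<^bsup>e\<^sub>i\<^esup> h\<^sub>i\<close>, this is possible only if \<open>p\<close> divides the denominator \<open>b\<close>, and \<open>b\<^bsup>e\<^sub>j\<^esup>\<close> divides \<open>h\<^sub>j\<close> for all \<open>j\<close>.\<close>
lemma p_visible_iff:
  assumes rep: "representative_choice w rep" and w: "\<forall>i. 0 < w $ i" and h: "h \<noteq> 0" and p: "prime p"
  shows "p_visible w rep p h \<longleftrightarrow> \<not> weighted_dvd (reduced_weight w h) p h"
proof
  show "\<not> weighted_dvd (reduced_weight w h) p h" if "p_visible w rep p h"
    using that weighted_dvd_imp_precedes[OF p w h]
    by (metis p_visible_iff_precedes[OF rep w h] linorder_not_less)
next
  let ?e = "reduced_weight w h"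
  assume nd: "\<not> weighted_dvd ?e p h"
  show "p_visible w rep p h"
    unfolding p_visible_iff_precedes[OF rep w h]
  proof (intro allI impI, rule ccontr)
    fix P assume P: "precedes w P h" and "\<not> vec_val p h \<le> vec_val p P"
    then have "vec_val p P < vec_val p h" by simp
    then obtain i where "val p (P $ i) < vec_val p h"
      unfolding vec_val_def[of p P] by (auto simp: Min_less_iff)
    also have "vec_val p h \<le> val p (h $ i)" unfolding vec_val_def by (intro Min_le) auto
    finally have lt: "val p (P $ i) < val p (h $ i)" .
    obtain a b :: nat where ab: "coprime a b" "1 < b"
      "\<And>i. int b ^ (?e $ i) * P $ i = int a ^ (?e $ i) * h $ i"
      using precedes_imp_ratio[OF w h P] by blast
    have "int p dvd int b"
    proof (rule ccontr)
      assume np: "\<not> int p dvd int b"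
      have P0: "P $ i \<noteq> 0" using lt by (auto simp: val_def)
      have "int b ^ (?e $ i) * P $ i \<noteq> 0" using P0 ab(2) by simp
      then have h0: "h $ i \<noteq> 0" and a0: "int a ^ (?e $ i) \<noteq> 0"
        unfolding ab(3) mult_eq_0_iff by blast+
      have "multiplicity (int p) (int b ^ (?e $ i)) = 0"
        using np p by (metis not_dvd_imp_multiplicity_0 prime_dvd_power prime_nat_int_transfer)
      then have "multiplicity (int p) (P $ i) = multiplicity (int p) (int b ^ (?e $ i) * P $ i)"
        using p P0 ab(2) by (subst prime_elem_multiplicity_mult_distrib) auto
      also have "\<dots> = multiplicity (int p) (int a ^ (?e $ i)) + multiplicity (int p) (h $ i)"
        unfolding ab(3) using p h0 a0 by (subst prime_elem_multiplicity_mult_distrib) auto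
      finally show False using lt P0 h0 by (simp add: val_def)
    qed
    then show False using weighted_dvd_of_ratio[OF ab(1) _ ab(3)] nd by blast
  qed
qed

text \<open>Any earlier lattice point comes from a denominator \<open>b > 1\<close>, and a prime factor of \<open>b\<close> witnesses the
divisibility.\<close>
lemma globally_visible_iff:
  assumes rep: "representative_choice w rep" and w: "\<forall>i. 0 < w $ i" and h: "h \<noteq> 0"
  shows "globally_visible w rep h \<longleftrightarrow> (\<forall>p. prime p \<longrightarrow> \<not> weighted_dvd (reduced_weight w h) p h)"
proof
  show "\<forall>p. prime p \<longrightarrow> \<not> weighted_dvd (reduced_weight w h) p h" if "globally_visible w rep h"
    using that weighted_dvd_imp_precedes[OF _ w h] globally_visible_iff_not_precedes[OF rep w h]
    by blast
next
  assume nd: "\<forall>p. prime p \<longrightarrow> \<not> weighted_dvd (reduced_weight w h) p h"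
  show "globally_visible w rep h"
    unfolding globally_visible_iff_not_precedes[OF rep w h]
  proof
    assume "\<exists>P. precedes w P h"
    then obtain P where P: "precedes w P h" ..
    obtain a b :: nat where ab: "coprime a b" "1 < b"
      "\<And>i. int b ^ (reduced_weight w h $ i) * P $ i = int a ^ (reduced_weight w h $ i) * h $ i"
      using precedes_imp_ratio[OF w h P] by blast
    obtain p where "prime p" "p dvd b" using prime_factor_nat[of b] ab(2) by auto
    then show False using weighted_dvd_of_ratio[OF ab(1) _ ab(3), of p] nd by simp
  qed
qed

lemma reduced_weight_eq:
  assumes "(GCD i. w $ i) = 1" "\<And>i. h $ i \<noteq> 0"
  shows "reduced_weight w h = w"
  using assms by (simp add: reduced_weight_def support_gcd_def vec_eq_iff)

section \<open>Counting congruent pairs in a box\<close>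

lemma card_residue_class_interval:
  fixes m a N :: int
  assumes "0 < m" "0 \<le> N"
  shows "\<bar>real (card {b \<in> {1..N}. m dvd b - a}) - N / m\<bar> \<le> 1"
proof -
  let ?l = "\<lfloor>- a / m :: real\<rfloor>" and ?u = "\<lfloor>(N - a) / m :: real\<rfloor>"
  have "?l < k \<longleftrightarrow> 1 \<le> a + m * k" "k \<le> ?u \<longleftrightarrow> a + m * k \<le> N" for k
  proof -
    have "?l < k \<longleftrightarrow> real_of_int (- a) < of_int (m * k)"
      using assms(1) by (simp add: floor_less_iff pos_divide_less_eq pos_minus_divide_less_eq mult.commute)
    then show "?l < k \<longleftrightarrow> 1 \<le> a + m * k" unfolding of_int_less_iff by linarith
    have "k \<le> ?u \<longleftrightarrow> real_of_int (m * k) \<le> of_int (N - a)"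
      using assms(1) by (simp add: le_floor_iff pos_le_divide_eq mult.commute)
    then show "k \<le> ?u \<longleftrightarrow> a + m * k \<le> N" unfolding of_int_le_iff by linarith
  qed
  then have "{b \<in> {1..N}. m dvd b - a} = (\<lambda>k. a + m * k) ` {?l<..?u}"
    by (auto simp: dvd_def image_iff eq_diff_eq algebra_simps)
  moreover have "inj_on (\<lambda>k. a + m * k) S" for S using assms(1) by (auto simp: inj_on_def)
  ultimately have "card {b \<in> {1..N}. m dvd b - a} = nat (?u - ?l)"
    by (simp add: card_image)
  moreover have "?l \<le> ?u" using assms by (intro floor_mono divide_right_mono) auto
  moreover have "(N - a) / m = (N / m + - a / m :: real)"
    by (simp add: diff_divide_distrib)
  ultimately show ?thesis by linarith
qed

definition congruent_pairs :: "int \<Rightarrow> (int \<times> int) set" where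
  "congruent_pairs m = {(a, b). m dvd b - a}"

lemma card_congruent_pairs:
  fixes m N :: int
  assumes "0 < m" "0 \<le> N"
  shows "\<bar>real (card (congruent_pairs m \<inter> {1..N} \<times> {1..N})) - N\<^sup>2 / m\<bar> \<le> N"
proof -
  have "congruent_pairs m \<inter> {1..N} \<times> {1..N} = (SIGMA a:{1..N}. {b \<in> {1..N}. m dvd b - a})"
    by (auto simp: congruent_pairs_def)
  moreover have "card (SIGMA a:{1..N}. {b \<in> {1..N}. m dvd b - a}) =
      (\<Sum>a\<in>{1..N}. card {b \<in> {1..N}. m dvd b - a})"
    by (rule card_SigmaI) (auto intro: finite_subset[of _ "{1..N}"])
  ultimately have "real (card (congruent_pairs m \<inter> {1..N} \<times> {1..N})) - N\<^sup>2 / m =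
      (\<Sum>a\<in>{1..N}. real (card {b \<in> {1..N}. m dvd b - a}) - N / m)"
    using assms(2) by (simp add: sum_subtractf power2_eq_square)
  also have "\<bar>\<dots>\<bar> \<le> (\<Sum>a\<in>{1..N}. 1)"
    by (intro order_trans[OF sum_abs] sum_mono card_residue_class_interval assms)
  finally show ?thesis using assms(2) by simp
qed

text \<open>Leaving out the diagonal is what removes the rounding term: for \<open>m > N\<close> no two distinct elements of
\<open>{1..N}\<close> are congruent, and for \<open>m \<le> N\<close> the error \<open>1\<close> in each residue class is at most \<open>N / m\<close>. A bound
proportional to \<open>1 / m\<close> for every \<open>N\<close> makes the sum over large moduli uniformly small.\<close>
lemma card_distinct_congruent_pairs_le:
  fixes m N :: int
  assumes "0 < m" "0 \<le> N"
  shows "real (card ((congruent_pairs m - Id) \<inter> {1..N} \<times> {1..N})) \<le> 2 * N\<^sup>2 / m"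
proof -
  have "(congruent_pairs m - Id) \<inter> {1..N} \<times> {1..N} =
      (SIGMA a:{1..N}. {b \<in> {1..N}. m dvd b - a} - {a})"
    by (auto simp: congruent_pairs_def)
  moreover have "card (SIGMA a:{1..N}. {b \<in> {1..N}. m dvd b - a} - {a}) =
      (\<Sum>a\<in>{1..N}. card ({b \<in> {1..N}. m dvd b - a} - {a}))"
    by (rule card_SigmaI) (auto intro: finite_subset[of _ "{1..N}"])
  ultimately have "real (card ((congruent_pairs m - Id) \<inter> {1..N} \<times> {1..N})) =
      (\<Sum>a\<in>{1..N}. real (card ({b \<in> {1..N}. m dvd b - a} - {a})))"
    by (simp only: of_nat_sum)
  also have "\<dots> \<le> (\<Sum>a\<in>{1..N}. 2 * N / m)"
  proof (rule sum_mono)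
    fix a assume a: "a \<in> {1..N}"
    show "real (card ({b \<in> {1..N}. m dvd b - a} - {a})) \<le> 2 * N / m"
    proof (cases "m \<le> N")
      case True
      have "real (card ({b \<in> {1..N}. m dvd b - a} - {a})) \<le> real (card {b \<in> {1..N}. m dvd b - a})"
        by (intro of_nat_mono card_mono) (auto intro: finite_subset[of _ "{1..N}"])
      also have "\<dots> \<le> N / m + 1"
        using card_residue_class_interval[OF assms, of a] by linarith
      also have "1 \<le> N / m" using True assms(1) by simp
      finally show ?thesis by simp
    next
      case False
      have "\<not> m dvd b - a" if "b \<in> {1..N}" "b \<noteq> a" for b
        using dvd_imp_le_int[of "b - a" m] that a False by auto
      then have "{b \<in> {1..N}. m dvd b - a} - {a} = {}" by auto
      then show ?thesis using assms by (simp only: card.empty) simp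
    qed
  qed
  finally show ?thesis using assms(2) by (simp add: power2_eq_square mult_ac)
qed

lemma card_pairs_in_box:
  fixes R :: "'n::finite \<Rightarrow> (int \<times> int) set"
  shows "card ({(A, B). \<forall>i. (A $ i, B $ i) \<in> R i} \<inter> lattice_box X \<times> lattice_box X) =
     (\<Prod>i\<in>UNIV. card (R i \<inter> {1..\<lfloor>X\<rfloor>} \<times> {1..\<lfloor>X\<rfloor>}))"
proof -
  have "bij_betw (\<lambda>(A, B) i. (A $ i, B $ i))
      ({(A, B). \<forall>i. (A $ i, B $ i) \<in> R i} \<inter> lattice_box X \<times> lattice_box X)
      (\<Pi>\<^sub>E i\<in>UNIV. R i \<inter> {1..\<lfloor>X\<rfloor>} \<times> {1..\<lfloor>X\<rfloor>})"
    by (rule bij_betw_byWitness[where f' = "\<lambda>f. (\<chi> i. fst (f i), \<chi> i. snd (f i))"])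
      (auto simp: lattice_box_def vec_eq_iff PiE_iff mem_Times_iff)
  then show ?thesis by (simp add: bij_betw_same_card card_PiE)
qed

lemma card_lattice_box_squared:
  "(real (card (lattice_box X :: (int ^ 'n) set)))\<^sup>2 = (\<Prod>i\<in>(UNIV :: 'n set). (real (nat \<lfloor>X\<rfloor>))\<^sup>2)"
proof -
  have "{(A :: int ^ 'n, B :: int ^ 'n). \<forall>i. (A $ i, B $ i) \<in> UNIV} = UNIV" by auto
  then have "card (lattice_box X \<times> lattice_box X :: ((int ^ 'n) \<times> (int ^ 'n)) set) =
      (\<Prod>i\<in>(UNIV :: 'n set). card ({1..\<lfloor>X\<rfloor>} \<times> {1..\<lfloor>X\<rfloor>}))"
    using card_pairs_in_box[where R = "\<lambda>_ :: 'n. UNIV"] by simp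
  then show ?thesis
    by (simp add: card_cartesian_product power2_eq_square flip: of_nat_mult of_nat_power)
qed

lemma finite_lattice_box [simp]: "finite (lattice_box X)"
proof -
  have "lattice_box X \<subseteq> (\<lambda>f. \<chi> i. f i) ` (\<Pi>\<^sub>E i\<in>UNIV. {1..\<lfloor>X\<rfloor>})"
  proof
    fix A :: "int ^ 'n" assume "A \<in> lattice_box X"
    then show "A \<in> (\<lambda>f. \<chi> i. f i) ` (\<Pi>\<^sub>E i\<in>UNIV. {1..\<lfloor>X\<rfloor>})"
      by (intro image_eqI[where x = "($) A"]) (auto simp: lattice_box_def)
  qed
  then show ?thesis by (rule finite_subset) (simp add: finite_PiE)
qed

section \<open>Calculus of pair densities\<close>

definition pair_proportion :: "((int ^ 'n) \<times> (int ^ 'n)) set \<Rightarrow> real \<Rightarrow> real" where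
  "pair_proportion V X = real (card (V \<inter> lattice_box X \<times> lattice_box X)) /
     (real (card (lattice_box X :: (int ^ 'n) set)))\<^sup>2"

lemma has_pair_density_iff: "has_pair_density V d \<longleftrightarrow> (pair_proportion V \<longlongrightarrow> d) at_top"
  unfolding has_pair_density_def pair_proportion_def ..

lemma pair_proportion_nonneg: "0 \<le> pair_proportion V X"
  by (simp add: pair_proportion_def)

lemma pair_proportion_mono:
  assumes "V \<inter> lattice_box X \<times> lattice_box X \<subseteq> U"
  shows "pair_proportion V X \<le> pair_proportion U X"
  unfolding pair_proportion_def
  by (intro divide_right_mono of_nat_mono card_mono) (use assms in auto)

lemma pair_proportion_UN_le:
  assumes "finite I"
  shows "pair_proportion (\<Union>i\<in>I. V i) X \<le> (\<Sum>i\<in>I. pair_proportion (V i) X)"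
proof -
  have "card ((\<Union>i\<in>I. V i) \<inter> lattice_box X \<times> lattice_box X) =
      card (\<Union>i\<in>I. V i \<inter> lattice_box X \<times> lattice_box X)"
    by (rule arg_cong[where f = card]) auto
  also have "\<dots> \<le> (\<Sum>i\<in>I. card (V i \<inter> lattice_box X \<times> lattice_box X))"
    by (rule card_UN_le[OF assms])
  finally have "real (card ((\<Union>i\<in>I. V i) \<inter> lattice_box X \<times> lattice_box X)) \<le>
      (\<Sum>i\<in>I. real (card (V i \<inter> lattice_box X \<times> lattice_box X)))"
    by (simp flip: of_nat_sum)
  then show ?thesis
    unfolding pair_proportion_def sum_divide_distrib[symmetric] by (rule divide_right_mono) simp
qed

lemma pair_proportion_Un_le: "pair_proportion (U \<union> V) X \<le> pair_proportion U X + pair_proportion V X"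
  using pair_proportion_UN_le[of UNIV "\<lambda>b. if b then U else V" X]
  by (simp add: UNIV_bool Un_commute)

lemma pair_proportion_Diff:
  assumes "U \<subseteq> V"
  shows "pair_proportion (V - U) X = pair_proportion V X - pair_proportion U X"
proof -
  have "card ((V - U) \<inter> lattice_box X \<times> lattice_box X) =
      card (V \<inter> lattice_box X \<times> lattice_box X) - card (U \<inter> lattice_box X \<times> lattice_box X)"
    unfolding Diff_Int_distrib2 by (rule card_Diff_subset) (use assms in auto)
  moreover have "card (U \<inter> lattice_box X \<times> lattice_box X) \<le> card (V \<inter> lattice_box X \<times> lattice_box X)"
    by (rule card_mono) (use assms in auto)
  ultimately show ?thesis
    by (simp add: pair_proportion_def of_nat_diff diff_divide_distrib)
qed

lemma has_pair_density_Diff: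
  assumes "has_pair_density V c" "has_pair_density U d" "U \<subseteq> V"
  shows "has_pair_density (V - U) (c - d)"
  using assms(1,2) unfolding has_pair_density_iff pair_proportion_Diff[OF assms(3)]
  by (rule tendsto_diff)

lemma has_pair_density_zero_UN:
  assumes "finite I" "\<And>i. i \<in> I \<Longrightarrow> has_pair_density (V i) 0"
  shows "has_pair_density (\<Union>i\<in>I. V i) 0"
proof -
  have "((\<lambda>X. \<Sum>i\<in>I. pair_proportion (V i) X) \<longlongrightarrow> (\<Sum>i\<in>I. 0)) at_top"
    using assms(2) unfolding has_pair_density_iff by (intro tendsto_sum) auto
  then show ?thesis
    unfolding has_pair_density_iff
    by (intro tendsto_sandwich[OF _ _ tendsto_const, of 0 "pair_proportion (\<Union>i\<in>I. V i)"])
      (auto simp: pair_proportion_nonneg intro!: always_eventually pair_proportion_UN_le assms(1))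
qed

lemma pair_proportion_product:
  fixes R :: "'n::finite \<Rightarrow> (int \<times> int) set"
  shows "pair_proportion {(A, B). \<forall>i. (A $ i, B $ i) \<in> R i} X =
    (\<Prod>i\<in>UNIV. real (card (R i \<inter> {1..\<lfloor>X\<rfloor>} \<times> {1..\<lfloor>X\<rfloor>})) / (real (nat \<lfloor>X\<rfloor>))\<^sup>2)"
  by (simp only: pair_proportion_def card_pairs_in_box card_lattice_box_squared prod_dividef of_nat_prod)

text \<open>Conditions that constrain each coordinate separately are independent: the proportion in a box
factors exactly, and so does its limit.\<close>
lemma has_pair_density_product:
  fixes R :: "'n::finite \<Rightarrow> (int \<times> int) set"
  assumes "\<And>i. ((\<lambda>N. real (card (R i \<inter> {1..int N} \<times> {1..int N})) / (real N)\<^sup>2) \<longlongrightarrow> d i) sequentially"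
  shows "has_pair_density {(A, B). \<forall>i. (A $ i, B $ i) \<in> R i} (\<Prod>i\<in>UNIV. d i)"
proof -
  have lim: "filterlim (\<lambda>X::real. nat \<lfloor>X\<rfloor>) sequentially at_top"
    by (rule filterlim_compose[OF filterlim_nat_sequentially filterlim_floor_sequentially])
  have I: "{1..int (nat k)} = {1..k}" for k by auto
  show ?thesis
    unfolding has_pair_density_iff pair_proportion_product
    using filterlim_compose[OF assms lim] unfolding I by (intro tendsto_prod) auto
qed

lemma congruent_pairs_density:
  assumes "0 < m"
  shows "(\<lambda>N. real (card (congruent_pairs m \<inter> {1..int N} \<times> {1..int N})) / (real N)\<^sup>2) \<longlonglongrightarrow> 1 / m"
proof (rule Lim_transform2)
  show "(\<lambda>N. 1 / real_of_int m) \<longlonglongrightarrow> 1 / m" by simp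
  have "\<bar>1 / real_of_int m - real (card (congruent_pairs m \<inter> {1..int N} \<times> {1..int N})) / (real N)\<^sup>2\<bar> \<le> 1 / N"
    if "N \<ge> 1" for N :: nat
  proof -
    let ?c = "real (card (congruent_pairs m \<inter> {1..int N} \<times> {1..int N}))"
    have "1 / real_of_int m - ?c / (real N)\<^sup>2 = - (?c - (real N)\<^sup>2 / m) / (real N)\<^sup>2"
      using that by (simp add: field_simps)
    also have "\<bar>\<dots>\<bar> = \<bar>?c - (real N)\<^sup>2 / m\<bar> / (real N)\<^sup>2"
      unfolding abs_divide abs_minus_cancel by simp
    also have "\<dots> \<le> real N / (real N)\<^sup>2"
      using card_congruent_pairs[OF assms, of "int N"] by (intro divide_right_mono) auto
    finally show ?thesis using that by (simp add: power2_eq_square)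
  qed
  then have "\<forall>\<^sub>F N in sequentially.
      norm (1 / real_of_int m - real (card (congruent_pairs m \<inter> {1..int N} \<times> {1..int N})) / (real N)\<^sup>2) \<le> 1 / N"
    by (auto intro!: eventually_sequentiallyI[of 1])
  then show "(\<lambda>N. 1 / real_of_int m - real (card (congruent_pairs m \<inter> {1..int N} \<times> {1..int N})) / (real N)\<^sup>2) \<longlonglongrightarrow> 0"
    by (rule Lim_null_comparison) (rule lim_1_over_n)
qed

definition degenerate_pairs :: "((int ^ 'n) \<times> (int ^ 'n)) set" where
  "degenerate_pairs = {(A, B). \<exists>i. A $ i = B $ i}"

text \<open>A coincidence in one coordinate is a product condition whose factor there is the diagonal, of
proportion \<open>1 / N\<close>.\<close>
lemma has_pair_density_degenerate_pairs:
  "has_pair_density (degenerate_pairs :: ((int ^ 'n) \<times> (int ^ 'n)) set) 0"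
proof -
  have "has_pair_density {(A :: int ^ 'n, B). A $ k = B $ k} 0" for k
  proof -
    have diag: "card (Id \<inter> {1..int N} \<times> {1..int N}) = N" for N
    proof -
      have "Id \<inter> {1..int N} \<times> {1..int N} = (\<lambda>a. (a, a)) ` {1..int N}" by auto
      then show ?thesis by (simp add: card_image inj_on_def)
    qed
    have inv: "real N / (real N)\<^sup>2 = 1 / real N" for N
      by (cases "N = 0") (auto simp: power2_eq_square)
    have "(\<lambda>N. real (card (Id \<inter> {1..int N} \<times> {1..int N})) / (real N)\<^sup>2) \<longlonglongrightarrow> 0"
      using lim_1_over_n[where 'a = real] by (simp only: diag inv)
    moreover have "\<forall>\<^sub>F N in sequentially. 1 = real (card ({1..int N} \<times> {1..int N})) / (real N)\<^sup>2"
      by (auto intro!: eventually_sequentiallyI[of 1] simp: card_cartesian_product power2_eq_square)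
    then have "(\<lambda>N. real (card ({1..int N} \<times> {1..int N})) / (real N)\<^sup>2) \<longlonglongrightarrow> 1"
      using tendsto_cong tendsto_const by fast
    ultimately have "has_pair_density {(A, B). \<forall>i. (A $ i, B $ i) \<in> (if i = k then Id else UNIV)}
        (\<Prod>i\<in>UNIV. if i = k then 0 else 1 :: real)"
      by (intro has_pair_density_product) simp
    moreover have "(\<Prod>i\<in>UNIV. if i = k then 0 else 1 :: real) = 0" by (intro prod_zero) auto
    moreover have "{(A :: int ^ 'n, B :: int ^ 'n). \<forall>i. (A $ i, B $ i) \<in> (if i = k then Id else UNIV)} = {(A, B). A $ k = B $ k}"
      by auto
    ultimately show ?thesis by simp
  qed
  then have "has_pair_density (\<Union>k. {(A :: int ^ 'n, B). A $ k = B $ k}) 0"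
    by (intro has_pair_density_zero_UN) auto
  moreover have "(\<Union>k. {(A :: int ^ 'n, B). A $ k = B $ k}) = degenerate_pairs"
    by (auto simp: degenerate_pairs_def)
  ultimately show ?thesis by simp
qed

text \<open>Densities are not countably additive, so the passage from finitely many primes to all of them needs
an approximation whose error is small uniformly in the box.\<close>
lemma has_pair_density_approx:
  assumes "\<And>e. 0 < e \<Longrightarrow> \<exists>U c. has_pair_density U c \<and> \<bar>c - d\<bar> \<le> e \<and>
      (\<forall>\<^sub>F X in at_top. pair_proportion ((V - U) \<union> (U - V)) X \<le> e)"
  shows "has_pair_density V d"
  unfolding has_pair_density_iff
proof (rule tendstoI)
  fix e :: real assume "0 < e"
  then obtain U c where U: "has_pair_density U c" "\<bar>c - d\<bar> \<le> e / 4"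
    "\<forall>\<^sub>F X in at_top. pair_proportion ((V - U) \<union> (U - V)) X \<le> e / 4"
    using assms[of "e / 4"] by auto
  have "\<forall>\<^sub>F X in at_top. dist (pair_proportion U X) c < e / 4"
    using U(1) \<open>0 < e\<close> unfolding has_pair_density_iff by (intro tendstoD) auto
  with U(3) show "\<forall>\<^sub>F X in at_top. dist (pair_proportion V X) d < e"
  proof eventually_elim
    case (elim X)
    let ?D = "(V - U) \<union> (U - V)"
    have "pair_proportion V X \<le> pair_proportion (U \<union> ?D) X"
      "pair_proportion U X \<le> pair_proportion (V \<union> ?D) X"
      by (auto intro!: pair_proportion_mono)
    then have "\<bar>pair_proportion V X - pair_proportion U X\<bar> \<le> pair_proportion ?D X"
      using pair_proportion_Un_le[of U ?D X] pair_proportion_Un_le[of V ?D X] by linarith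
    then show ?case
      using elim U(2) \<open>0 < e\<close> unfolding dist_real_def by linarith
  qed
qed

section \<open>Sieving by finitely many primes\<close>

lemma weighted_dvd_mult_coprime:
  assumes "coprime a b"
  shows "weighted_dvd w (a * b) h \<longleftrightarrow> weighted_dvd w a h \<and> weighted_dvd w b h"
proof -
  have "int (a * b) ^ k dvd x \<longleftrightarrow> int a ^ k dvd x \<and> int b ^ k dvd x" for k x
    using assms by (auto simp: power_mult_distrib intro: divides_mult dvd_mult_left dvd_mult_right)
  then show ?thesis by (auto simp: weighted_dvd_def)
qed

text \<open>The divisor \<open>d\<close> is carried along because removing the prime \<open>p\<close> from the pairs for \<open>d\<close> subtracts the pairs
for \<open>d * p\<close>; only \<open>d = 1\<close> is wanted in the end.\<close>
definition sieved_pairs :: "nat ^ 'n \<Rightarrow> nat \<Rightarrow> nat set \<Rightarrow> ((int ^ 'n) \<times> (int ^ 'n)) set" where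
  "sieved_pairs w d T =
     {(A, B). weighted_dvd w d (B - A) \<and> (\<forall>p\<in>T. \<not> weighted_dvd w p (B - A))}"

lemma has_pair_density_weighted_dvd:
  assumes "0 < d"
  shows "has_pair_density {(A, B). weighted_dvd w d (B - A)} (1 / real d ^ (\<Sum>i\<in>UNIV. w $ i))"
proof -
  have "has_pair_density {(A, B). \<forall>i. (A $ i, B $ i) \<in> congruent_pairs (int d ^ (w $ i))}
      (\<Prod>i\<in>UNIV. 1 / real_of_int (int d ^ (w $ i)))"
    using assms by (intro has_pair_density_product congruent_pairs_density) simp
  moreover have "(\<Prod>i\<in>UNIV. 1 / real_of_int (int d ^ (w $ i))) = 1 / real d ^ (\<Sum>i\<in>UNIV. w $ i)"
    by (simp add: prod_dividef power_sum)
  ultimately show ?thesis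
    by (simp add: congruent_pairs_def weighted_dvd_def)
qed

text \<open>Induction on \<open>T\<close>: for coprime \<open>d\<close> and \<open>p\<close>, the pairs lost on adding \<open>p\<close> to \<open>T\<close> are exactly those sieved by \<open>T\<close> for
\<open>d * p\<close>, a fraction \<open>1 / p\<^bsup>W\<^esup>\<close> of the whole.\<close>
lemma has_pair_density_sieved_pairs:
  assumes "finite T" "\<And>p. p \<in> T \<Longrightarrow> prime p \<and> \<not> p dvd d" "0 < d"
  shows "has_pair_density (sieved_pairs w d T)
     (1 / real d ^ (\<Sum>i\<in>UNIV. w $ i) * (\<Prod>p\<in>T. 1 - 1 / real p ^ (\<Sum>i\<in>UNIV. w $ i)))"
  using assms
proof (induction T arbitrary: d rule: finite_induct)
  case empty
  then show ?case using has_pair_density_weighted_dvd[of d w] by (simp add: sieved_pairs_def)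
next
  case (insert p T)
  let ?W = "\<Sum>i\<in>UNIV. w $ i" and ?\<Pi> = "\<Prod>p\<in>T. 1 - 1 / real p ^ (\<Sum>i\<in>UNIV. w $ i)"
  have p: "prime p" "coprime d p"
    using insert.prems(1)[of p] prime_imp_coprime coprime_commute by auto
  have "\<not> q dvd d * p" if "q \<in> T" for q
    using insert.prems(1)[of q] that insert.hyps(2) p(1)
    by (metis insertI2 prime_dvd_mult_iff primes_dvd_imp_eq)
  then have "has_pair_density (sieved_pairs w (d * p) T) (1 / real (d * p) ^ ?W * ?\<Pi>)"
    using insert.prems p(1) by (intro insert.IH) (auto simp: prime_gt_0_nat)
  moreover have "has_pair_density (sieved_pairs w d T) (1 / real d ^ ?W * ?\<Pi>)"
    using insert.prems by (intro insert.IH) auto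
  ultimately have "has_pair_density (sieved_pairs w d T - sieved_pairs w (d * p) T)
      (1 / real d ^ ?W * ?\<Pi> - 1 / real (d * p) ^ ?W * ?\<Pi>)"
    by (intro has_pair_density_Diff) (auto simp: sieved_pairs_def weighted_dvd_mult_coprime[OF p(2)])
  also have "sieved_pairs w d T - sieved_pairs w (d * p) T = sieved_pairs w d (insert p T)"
    by (auto simp: sieved_pairs_def weighted_dvd_mult_coprime[OF p(2)])
  also have "1 / real d ^ ?W * ?\<Pi> - 1 / real (d * p) ^ ?W * ?\<Pi> =
      1 / real d ^ ?W * (\<Prod>p\<in>insert p T. 1 - 1 / real p ^ ?W)"
    using insert.hyps by (simp add: power_mult_distrib algebra_simps)
  finally show ?case .
qed

section \<open>The contribution of large divisors\<close>

lemma sum_inverse_powers_tail: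
  assumes "2 \<le> W" "1 \<le> M"
  shows "(\<Sum>k\<in>{M<..L}. 1 / real k ^ W) \<le> 1 / real M"
proof (cases "M \<le> L")
  case True
  \<comment> \<open>telescoping, since \<open>1 / k\<^sup>2 \<le> 1 / (k - 1) - 1 / k\<close>\<close>
  then have "(\<Sum>k\<in>{M<..L}. 1 / real k ^ W) \<le> 1 / real M - 1 / real L"
  proof (induction L rule: dec_induct)
    case (step L)
    have "{M<..Suc L} = insert (Suc L) {M<..L}" using step by auto
    then have "(\<Sum>k\<in>{M<..Suc L}. 1 / real k ^ W) \<le> 1 / real (Suc L) ^ W + (1 / real M - 1 / real L)"
      using step.IH by simp
    also have "1 / real (Suc L) ^ W \<le> 1 / real (Suc L) ^ 2"
      using assms(1) by (intro divide_left_mono power_increasing) auto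
    also have "\<dots> \<le> 1 / (real L * real (Suc L))"
      using step(1) assms(2) by (intro divide_left_mono) (auto simp: power2_eq_square)
    also have "\<dots> = 1 / real L - 1 / real (Suc L)"
      using step(1) assms(2) by (simp add: field_simps)
    finally show ?case by simp
  qed simp
  then show ?thesis by (smt (verit) of_nat_0_le_iff zero_le_divide_1_iff)
qed simp

lemma pair_proportion_weighted_dvd_le:
  fixes w :: "nat ^ 'n"
  assumes "0 < d"
  shows "pair_proportion ({(A, B). weighted_dvd w d (B - A)} - degenerate_pairs) X \<le>
     2 ^ CARD('n) / real d ^ (\<Sum>i\<in>UNIV. w $ i)"
proof -
  let ?R = "\<lambda>i. congruent_pairs (int d ^ (w $ i)) - Id"
  have "{(A, B). weighted_dvd w d (B - A)} - degenerate_pairs = {(A, B). \<forall>i. (A $ i, B $ i) \<in> ?R i}"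
    by (auto simp: weighted_dvd_def degenerate_pairs_def congruent_pairs_def)
  then have "pair_proportion ({(A, B). weighted_dvd w d (B - A)} - degenerate_pairs) X =
      (\<Prod>i\<in>UNIV. real (card (?R i \<inter> {1..\<lfloor>X\<rfloor>} \<times> {1..\<lfloor>X\<rfloor>})) / (real (nat \<lfloor>X\<rfloor>))\<^sup>2)"
    by (simp only: pair_proportion_product)
  also have "\<dots> \<le> (\<Prod>i\<in>UNIV. 2 / real d ^ (w $ i))"
  proof (rule prod_mono, intro conjI)
    fix i
    show "real (card (?R i \<inter> {1..\<lfloor>X\<rfloor>} \<times> {1..\<lfloor>X\<rfloor>})) / (real (nat \<lfloor>X\<rfloor>))\<^sup>2 \<le> 2 / real d ^ (w $ i)"
    proof (cases "1 \<le> \<lfloor>X\<rfloor>")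
      case True
      have "real (card (?R i \<inter> {1..\<lfloor>X\<rfloor>} \<times> {1..\<lfloor>X\<rfloor>})) \<le> 2 * real_of_int \<lfloor>X\<rfloor> ^ 2 / real d ^ (w $ i)"
        using card_distinct_congruent_pairs_le[of "int d ^ (w $ i)" "\<lfloor>X\<rfloor>"] True assms by simp
      then have "real (card (?R i \<inter> {1..\<lfloor>X\<rfloor>} \<times> {1..\<lfloor>X\<rfloor>})) / (real (nat \<lfloor>X\<rfloor>))\<^sup>2 \<le>
          (2 * real_of_int \<lfloor>X\<rfloor> ^ 2 / real d ^ (w $ i)) / (real (nat \<lfloor>X\<rfloor>))\<^sup>2"
        by (rule divide_right_mono) simp
      also have "\<dots> = 2 / real d ^ (w $ i)"
      proof -
        have "real (nat \<lfloor>X\<rfloor>) = of_int \<lfloor>X\<rfloor>" "real_of_int \<lfloor>X\<rfloor> \<noteq> 0" using True by linarith+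
        then show ?thesis by simp
      qed
      finally show ?thesis .
    qed simp
  qed simp
  also have "\<dots> = 2 ^ CARD('n) / real d ^ (\<Sum>i\<in>UNIV. w $ i)"
    by (simp add: prod_dividef power_sum)
  finally show ?thesis .
qed

text \<open>Off the degenerate pairs a divisor is bounded by the side of the box, since all weights are positive.
So finitely many \<open>d\<close> are involved and the union bound applies; the result does not depend on the box.\<close>
lemma pair_proportion_large_divisor_le:
  fixes w :: "nat ^ 'n"
  assumes "2 \<le> (\<Sum>i\<in>UNIV. w $ i)" "1 \<le> M" and w: "\<forall>i. 0 < w $ i"
  shows "pair_proportion ({(A, B). \<exists>d>M. weighted_dvd w d (B - A)} - degenerate_pairs) X \<le> 2 ^ CARD('n) / real M"
proof -
  let ?W = "\<Sum>i\<in>UNIV. w $ i"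
  let ?D = "\<lambda>d. {(A, B). weighted_dvd w d (B - A)} - degenerate_pairs"
  let ?I = "{M<..nat \<lfloor>X\<rfloor>}"
  have "d \<in> ?I" if AB: "A \<in> lattice_box X" "B \<in> lattice_box X" "(A, B) \<notin> degenerate_pairs"
    and d: "M < d" "weighted_dvd w d (B - A)" for A B :: "int ^ 'n" and d
  proof -
    fix i :: 'n
    have "A $ i \<noteq> B $ i" "A $ i \<in> {1..\<lfloor>X\<rfloor>}" "B $ i \<in> {1..\<lfloor>X\<rfloor>}"
      using AB by (auto simp: degenerate_pairs_def lattice_box_def)
    moreover have "int d dvd B $ i - A $ i"
    proof (rule dvd_trans)
      show "int d dvd int d ^ (w $ i)" using w by (simp add: dvd_power)
      show "int d ^ (w $ i) dvd B $ i - A $ i" using d(2) by (auto simp: weighted_dvd_def)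
    qed
    ultimately have "int d \<le> \<bar>B $ i - A $ i\<bar>" "\<bar>B $ i - A $ i\<bar> \<le> \<lfloor>X\<rfloor>"
      using dvd_imp_le_int[of "B $ i - A $ i" "int d"] by auto
    then show ?thesis using d(1) by auto
  qed
  then have "pair_proportion ({(A, B). \<exists>d>M. weighted_dvd w d (B - A)} - degenerate_pairs) X \<le>
      pair_proportion (\<Union>d\<in>?I. ?D d) X"
    by (intro pair_proportion_mono) blast
  also have "\<dots> \<le> (\<Sum>d\<in>?I. pair_proportion (?D d) X)"
    by (rule pair_proportion_UN_le) simp
  also have "\<dots> \<le> (\<Sum>d\<in>?I. 2 ^ CARD('n) / real d ^ ?W)"
    by (intro sum_mono pair_proportion_weighted_dvd_le) auto
  also have "\<dots> = 2 ^ CARD('n) * (\<Sum>d\<in>?I. 1 / real d ^ ?W)"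
    by (simp add: sum_distrib_left)
  also have "\<dots> \<le> 2 ^ CARD('n) * (1 / real M)"
    by (intro mult_left_mono sum_inverse_powers_tail assms) simp
  finally show ?thesis by simp
qed

section \<open>The Euler product of the zeta function\<close>

lemma zeta_has_sum:
  assumes "2 \<le> W"
  shows "((\<lambda>k. 1 / real k ^ W) has_sum zeta (real W)) {0<..}"
proof -
  have "summable (\<lambda>k. 1 / real k ^ W)"
    using inverse_power_summable[OF assms, where 'a = real] by (simp add: divide_inverse)
  then have s: "summable (\<lambda>k. 1 / real (Suc k) ^ W)" by (rule summable_ignore_initial_segment[of _ 1, simplified])
  have "zeta (real W) = (\<Sum>k. 1 / real (Suc k) ^ W)"
    unfolding zeta_def by (simp add: powr_realpow)
  then have "(\<lambda>k. 1 / real (Suc k) ^ W) sums zeta (real W)"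
    using s by (simp add: summable_sums)
  then have "((\<lambda>k. 1 / real (Suc k) ^ W) has_sum zeta (real W)) UNIV"
    using s by (intro norm_summable_imp_has_sum) simp_all
  then have "((\<lambda>k. 1 / real k ^ W) has_sum zeta (real W)) (range Suc)"
    by (subst has_sum_reindex) (auto simp: o_def)
  also have "range Suc = {0<..}" by (auto simp: image_iff gr0_conv_Suc)
  finally show ?thesis .
qed

text \<open>The Euler sieve: among the integers free of primes in \<open>T\<close>, the multiples of a further prime \<open>p\<close> form the \<open>p\<close>-fold dilation
of the whole set, which carries the fraction \<open>1 / p\<^bsup>W\<^esup>\<close> of its mass.\<close>
lemma sieved_zeta_has_sum:
  assumes "2 \<le> W" "finite T" "\<And>p. p \<in> T \<Longrightarrow> prime p"
  shows "((\<lambda>k. 1 / real k ^ W) has_sum zeta (real W) * (\<Prod>p\<in>T. 1 - 1 / real p ^ W))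
     {k. 0 < k \<and> (\<forall>p\<in>T. \<not> p dvd k)}"
  using assms(2,3)
proof (induction T rule: finite_induct)
  case empty
  show ?case using zeta_has_sum[OF assms(1)] by (simp add: greaterThan_def)
next
  case (insert p T)
  let ?f = "\<lambda>k. 1 / real k ^ W" and ?S = "{k. 0 < k \<and> (\<forall>p\<in>T. \<not> p dvd k)}"
  let ?z = "zeta (real W) * (\<Prod>p\<in>T. 1 - 1 / real p ^ W)"
  have p: "prime p" "0 < p" using insert.prems by (auto simp: prime_gt_0_nat)
  have S: "(?f has_sum ?z) ?S" using insert by auto
  then have "((\<lambda>k. 1 / real p ^ W * ?f k) has_sum 1 / real p ^ W * ?z) ?S"
    by (rule has_sum_cmult_right)
  then have "(?f has_sum 1 / real p ^ W * ?z) ((*) p ` ?S)"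
    using p by (subst has_sum_reindex) (auto simp: o_def inj_on_def power_mult_distrib)
  moreover have dvd: "q dvd p * k \<longleftrightarrow> q dvd k" if "q \<in> T" for q k
    using that insert.prems[of q] insert.hyps(2) p(1)
    by (metis insertI2 prime_dvd_mult_iff primes_dvd_imp_eq)
  moreover have "(*) p ` ?S \<subseteq> ?S" using p(2) by (auto simp: dvd)
  ultimately have "(?f has_sum ?z - 1 / real p ^ W * ?z) (?S - (*) p ` ?S)"
    using S by (intro has_sum_Diff) auto
  moreover have "?S - (*) p ` ?S = {k. 0 < k \<and> (\<forall>q\<in>insert p T. \<not> q dvd k)}"
    using p(2) by (auto simp: dvd elim!: dvdE)
  moreover have "?z - 1 / real p ^ W * ?z = zeta (real W) * (\<Prod>q\<in>insert p T. 1 - 1 / real q ^ W)"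
    using insert.hyps by (simp add: algebra_simps)
  ultimately show ?case by simp
qed

text \<open>After sieving by the primes up to \<open>M\<close> only \<open>1\<close> and integers beyond \<open>M\<close> remain.\<close>
lemma euler_product_bounds:
  assumes "2 \<le> W" "1 \<le> M"
  shows "zeta (real W) * (\<Prod>p | prime p \<and> p \<le> M. 1 - 1 / real p ^ W) \<in> {1..1 + 1 / real M}"
proof -
  let ?f = "\<lambda>k. 1 / real k ^ W" and ?T = "{p. prime p \<and> p \<le> M}"
  let ?S = "{k. 0 < k \<and> (\<forall>p\<in>?T. \<not> p dvd k)}"
  have S: "(?f has_sum zeta (real W) * (\<Prod>p\<in>?T. 1 - 1 / real p ^ W)) ?S"
    by (rule sieved_zeta_has_sum[OF assms(1)]) auto
  have "1 \<in> ?S" using not_prime_1 by auto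
  then have "sum ?f {1} \<le> zeta (real W) * (\<Prod>p\<in>?T. 1 - 1 / real p ^ W)"
    by (intro finite_sum_le_has_sum[OF S]) auto
  moreover have "zeta (real W) * (\<Prod>p\<in>?T. 1 - 1 / real p ^ W) \<le> 1 + 1 / real M"
  proof (rule has_sum_le_finite_sums[OF S])
    fix F assume F: "finite F" "F \<subseteq> ?S"
    have "F \<subseteq> insert 1 {M<..Max (insert 0 F)}"
    proof
      fix k assume k: "k \<in> F"
      have "M < k" if k1: "k \<noteq> 1"
      proof -
        obtain q where q: "prime q" "q dvd k" using k1 prime_factor_nat by blast
        then have "\<not> q \<le> M" using k F(2) by blast
        moreover have "q \<le> k" using q(2) k F(2) by (intro dvd_imp_le) auto
        ultimately show ?thesis by linarith
      qed
      then show "k \<in> insert 1 {M<..Max (insert 0 F)}" using k F(1) by auto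
    qed
    then have "sum ?f F \<le> sum ?f (insert 1 {M<..Max (insert 0 F)})"
      by (intro sum_mono2) auto
    also have "\<dots> = 1 + sum ?f {M<..Max (insert 0 F)}" using assms(2) by simp
    also have "\<dots> \<le> 1 + 1 / real M"
      using sum_inverse_powers_tail[OF assms] by simp
    finally show "sum ?f F \<le> 1 + 1 / real M" .
  qed
  ultimately show ?thesis by simp
qed

lemma euler_product_tendsto:
  assumes "2 \<le> W"
  shows "zeta (real W) > 0"
    and "(\<lambda>M. \<Prod>p | prime p \<and> p \<le> M. 1 - 1 / real p ^ W) \<longlonglongrightarrow> 1 / zeta (real W)"
proof -
  let ?P = "\<lambda>M. \<Prod>p | prime p \<and> p \<le> M. 1 - 1 / real p ^ W"
  have "\<not> (prime p \<and> p \<le> 1)" for p :: nat using prime_gt_1_nat[of p] by auto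
  then have "{p::nat. prime p \<and> p \<le> 1} = {}" by blast
  then have "?P 1 = 1" by (simp only: prod.empty)
  then have "1 \<le> zeta (real W)" using euler_product_bounds[OF assms, of 1] by simp
  then show z: "zeta (real W) > 0" by simp
  have "(\<lambda>M. zeta (real W) * ?P M) \<longlonglongrightarrow> 1"
  proof (rule tendsto_sandwich[where f = "\<lambda>_. 1" and h = "\<lambda>M. 1 + 1 / real M"])
    show "(\<lambda>M. 1 + 1 / real M) \<longlonglongrightarrow> 1"
      using tendsto_add[OF tendsto_const lim_1_over_n, of "1 :: real"] by simp
  qed (use euler_product_bounds[OF assms] in \<open>auto intro!: eventually_sequentiallyI[of 1]\<close>)
  then have "(\<lambda>M. 1 / zeta (real W) * (zeta (real W) * ?P M)) \<longlonglongrightarrow> 1 / zeta (real W) * 1"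
    by (rule tendsto_mult_left)
  then show "?P \<longlonglongrightarrow> 1 / zeta (real W)" using z by simp
qed

text \<open>Convergence as an infinite product demands a nonzero limit, which is why positivity of zeta is
established with the limit.\<close>
lemma has_prod_euler_product:
  assumes "2 \<le> W"
  shows "(\<lambda>p. if prime p then 1 - 1 / real p ^ W else 1) has_prod (1 / zeta (real W))"
proof -
  have "(\<Prod>i\<le>M. if prime i then 1 - 1 / real i ^ W else 1) = (\<Prod>p | prime p \<and> p \<le> M. 1 - 1 / real p ^ W)" for M
    by (subst prod.inter_filter[symmetric]) (auto intro!: prod.cong)
  then show ?thesis
    using euler_product_tendsto[OF assms]
    unfolding has_prod_def raw_has_prod_def add_0_right by simp
qed

section \<open>Densities of visible pairs\<close>

context
  fixes w :: "nat ^ 'n" and rep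
  assumes rep: "representative_choice w rep" and w: "\<forall>i. 0 < w $ i" and gcd: "(GCD i. w $ i) = 1"
begin

text \<open>When no coordinate of \<open>B - A\<close> vanishes, the gcd on the support is the gcd of all weights, so the
reduced weights are the weights themselves.\<close>
lemma nondegenerate_visibility:
  assumes "(A, B) \<notin> degenerate_pairs"
  shows "prime p \<Longrightarrow> (A, B) \<in> p_visible_pairs w rep p \<longleftrightarrow> \<not> weighted_dvd w p (B - A)"
    and "(A, B) \<in> visible_pairs w rep \<longleftrightarrow> (\<forall>p. prime p \<longrightarrow> \<not> weighted_dvd w p (B - A))"
proof -
  have ne: "(B - A) $ i \<noteq> 0" for i using assms by (simp add: degenerate_pairs_def) metis
  then have h: "B - A \<noteq> 0" by (metis zero_index)
  have e: "reduced_weight w (B - A) = w" by (rule reduced_weight_eq[OF gcd ne])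
  show "(A, B) \<in> p_visible_pairs w rep p \<longleftrightarrow> \<not> weighted_dvd w p (B - A)" if "prime p"
    using p_visible_iff[OF rep w h that] h by (auto simp: p_visible_pairs_def e)
  show "(A, B) \<in> visible_pairs w rep \<longleftrightarrow> (\<forall>p. prime p \<longrightarrow> \<not> weighted_dvd w p (B - A))"
    using globally_visible_iff[OF rep w h] h by (auto simp: visible_pairs_def e)
qed

lemma has_pair_density_p_visible_pairs:
  assumes "prime p"
  shows "has_pair_density (p_visible_pairs w rep p) (1 - 1 / real p ^ (\<Sum>i\<in>UNIV. w $ i))"
proof (rule has_pair_density_approx)
  fix e :: real assume e: "0 < e"
  let ?Z = "degenerate_pairs :: ((int ^ 'n) \<times> (int ^ 'n)) set"
  let ?V = "p_visible_pairs w rep p" and ?U = "sieved_pairs w 1 {p}"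
  have "has_pair_density ?U (1 - 1 / real p ^ (\<Sum>i\<in>UNIV. w $ i))"
    using has_pair_density_sieved_pairs[of "{p}" 1 w] assms prime_gt_1_nat[OF assms] by simp
  moreover have sub: "(?V - ?U) \<union> (?U - ?V) \<subseteq> degenerate_pairs"
    using nondegenerate_visibility(1)[OF _ assms] by (auto simp: sieved_pairs_def weighted_dvd_def)
  have le: "pair_proportion ((?V - ?U) \<union> (?U - ?V)) X \<le> pair_proportion ?Z X" for X
    by (intro pair_proportion_mono order_trans[OF Int_lower1 sub])
  have "\<forall>\<^sub>F X in at_top. pair_proportion ?Z X < e"
    using has_pair_density_degenerate_pairs e unfolding has_pair_density_iff by (rule order_tendstoD)
  then have "\<forall>\<^sub>F X in at_top. pair_proportion ((?V - ?U) \<union> (?U - ?V)) X \<le> e"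
  proof eventually_elim
    case (elim X)
    with le[of X] show ?case by linarith
  qed
  ultimately show "\<exists>U c. has_pair_density U c \<and> \<bar>c - (1 - 1 / real p ^ (\<Sum>i\<in>UNIV. w $ i))\<bar> \<le> e \<and>
      (\<forall>\<^sub>F X in at_top. pair_proportion ((?V - U) \<union> (U - ?V)) X \<le> e)"
    using e by (intro exI[of _ ?U] exI[of _ "1 - 1 / real p ^ (\<Sum>i\<in>UNIV. w $ i)"]) simp
qed

text \<open>The visible pairs differ from those sieved by the primes up to \<open>M\<close> only in degenerate pairs and in pairs
affected by a prime beyond \<open>M\<close>.\<close>
lemma has_pair_density_visible_pairs:
  assumes W: "2 \<le> (\<Sum>i\<in>UNIV. w $ i)"
  shows "has_pair_density (visible_pairs w rep) (1 / zeta (real (\<Sum>i\<in>UNIV. w $ i)))"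
proof (rule has_pair_density_approx)
  fix e :: real assume e: "0 < e"
  let ?Z = "degenerate_pairs :: ((int ^ 'n) \<times> (int ^ 'n)) set"
  let ?W = "\<Sum>i\<in>UNIV. w $ i" and ?V = "visible_pairs w rep"
  let ?P = "\<lambda>M. \<Prod>p | prime p \<and> p \<le> M. 1 - 1 / real p ^ (\<Sum>i\<in>UNIV. w $ i)"
  let ?U = "\<lambda>M. sieved_pairs w 1 {p. prime p \<and> p \<le> M}"
  have "\<forall>\<^sub>F M in sequentially. dist (?P M) (1 / zeta (real ?W)) < e"
    using euler_product_tendsto(2)[OF W] e by (rule tendstoD)
  moreover have "(\<lambda>M. 2 ^ CARD('n) * (1 / real M)) \<longlonglongrightarrow> 2 ^ CARD('n) * 0"
    by (intro tendsto_mult_left lim_1_over_n)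
  then have "\<forall>\<^sub>F M in sequentially. 2 ^ CARD('n) * (1 / real M) < e / 2"
    using e by (intro order_tendstoD(2)) auto
  ultimately have "\<forall>\<^sub>F M in sequentially. dist (?P M) (1 / zeta (real ?W)) < e \<and>
      2 ^ CARD('n) / real M < e / 2 \<and> 1 \<le> M"
    using eventually_ge_at_top[of 1] by eventually_elim simp
  then obtain M where M: "dist (?P M) (1 / zeta (real ?W)) < e" "2 ^ CARD('n) / real M < e / 2" "1 \<le> M"
    using eventually_happens'[OF sequentially_bot] by blast
  let ?D = "{(A :: int ^ 'n, B). \<exists>d>M. weighted_dvd w d (B - A)} - degenerate_pairs"
  have "has_pair_density (?U M) (1 / real 1 ^ ?W * ?P M)"
    by (intro has_pair_density_sieved_pairs) (auto dest: prime_gt_1_nat)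
  then have "has_pair_density (?U M) (?P M)" by simp
  moreover have sub: "(?V - ?U M) \<union> (?U M - ?V) \<subseteq> degenerate_pairs \<union> ?D"
  proof (rule subrelI, rule ccontr)
    fix A B :: "int ^ 'n"
    assume AB: "(A, B) \<in> (?V - ?U M) \<union> (?U M - ?V)" and "(A, B) \<notin> degenerate_pairs \<union> ?D"
    then have nd: "(A, B) \<notin> degenerate_pairs" and "\<not> (\<exists>d>M. weighted_dvd w d (B - A))" by auto
    then have "(\<forall>p. prime p \<longrightarrow> \<not> weighted_dvd w p (B - A)) \<longleftrightarrow>
        (\<forall>p. prime p \<and> p \<le> M \<longrightarrow> \<not> weighted_dvd w p (B - A))"
      by (meson not_le)
    moreover have one: "weighted_dvd w 1 (B - A)" by (simp add: weighted_dvd_def)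
    have "(A, B) \<in> ?U M \<longleftrightarrow> (\<forall>p. prime p \<and> p \<le> M \<longrightarrow> \<not> weighted_dvd w p (B - A))"
      using one unfolding sieved_pairs_def by blast
    ultimately show False
      using AB nondegenerate_visibility(2)[OF nd] by blast
  qed
  have le: "pair_proportion ((?V - ?U M) \<union> (?U M - ?V)) X \<le>
      pair_proportion ?Z X + pair_proportion ?D X" for X
    by (rule order_trans[OF pair_proportion_mono pair_proportion_Un_le]) (rule order_trans[OF Int_lower1 sub])
  have "\<forall>\<^sub>F X in at_top. pair_proportion ?Z X < e / 2"
    using has_pair_density_degenerate_pairs e unfolding has_pair_density_iff
    by (intro order_tendstoD) auto
  then have "\<forall>\<^sub>F X in at_top. pair_proportion ((?V - ?U M) \<union> (?U M - ?V)) X \<le> e"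
  proof eventually_elim
    case (elim X)
    have "pair_proportion ?D X \<le> 2 ^ CARD('n) / real M"
      by (rule pair_proportion_large_divisor_le[OF W M(3) w])
    with le[of X] elim M(2) show ?case by linarith
  qed
  ultimately show "\<exists>U c. has_pair_density U c \<and> \<bar>c - 1 / zeta (real ?W)\<bar> \<le> e \<and>
      (\<forall>\<^sub>F X in at_top. pair_proportion ((?V - U) \<union> (U - ?V)) X \<le> e)"
    using M(1) by (intro exI[of _ "?U M"] exI[of _ "?P M"]) (simp add: dist_real_def)
qed

end

section \<open>The local-global principle and the pair densities\<close>

theorem theorem1p8:
  fixes w :: "nat ^ 'n"
    and rep :: "((int ^ 'n) \<times> (rat ^ 'n)) set \<Rightarrow> (int ^ 'n) \<times> (rat ^ 'n)"
    and W :: nat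
  assumes "CARD('n) \<ge> 2"
    and "\<forall>i. 0 < w $ i"
    and "(GCD i. w $ i) = 1"
    and "W = (\<Sum>i\<in>UNIV. w $ i)"
    and "representative_choice w rep"
  shows "(\<forall>A B. A \<noteq> B \<longrightarrow>
           (globally_visible w rep (B - A) \<longleftrightarrow> (\<forall>p. prime p \<longrightarrow> p_visible w rep p (B - A)))) \<and>
         visible_pairs w rep = (\<Inter>p\<in>{p. prime p}. p_visible_pairs w rep p) \<and>
         (\<forall>p. prime p \<longrightarrow> has_pair_density (p_visible_pairs w rep p) (1 - 1 / real p ^ W)) \<and>
         (\<exists>d. has_pair_density (visible_pairs w rep) d \<and>
           (\<lambda>p. if prime p then 1 - 1 / real p ^ W else 1) has_prod d \<and>
           d = 1 / zeta (real W))"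
proof -
  note w = assms(2) and gcd = assms(3) and rep = assms(5)
  have "CARD('n) = (\<Sum>i\<in>(UNIV :: 'n set). 1)" by simp
  also have "\<dots> \<le> W" unfolding assms(4) using w by (intro sum_mono) (simp add: Suc_leI)
  finally have W: "2 \<le> W" using assms(1) by simp
  have local_global: "globally_visible w rep (B - A) \<longleftrightarrow> (\<forall>p. prime p \<longrightarrow> p_visible w rep p (B - A))"
    if "A \<noteq> B" for A B :: "int ^ 'n"
  proof -
    have "B - A \<noteq> 0" using that by simp
    then show ?thesis using p_visible_iff[OF rep w] globally_visible_iff[OF rep w] by blast
  qed
  moreover have "visible_pairs w rep = (\<Inter>p\<in>{p. prime p}. p_visible_pairs w rep p)"
  proof -
    have "\<exists>p::nat. prime p" using two_is_prime_nat by blast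
    then show ?thesis using local_global by (auto simp: visible_pairs_def p_visible_pairs_def)
  qed
  moreover have "has_pair_density (p_visible_pairs w rep p) (1 - 1 / real p ^ W)" if "prime p" for p
    unfolding assms(4) by (rule has_pair_density_p_visible_pairs[OF rep w gcd that])
  moreover have "has_pair_density (visible_pairs w rep) (1 / zeta (real W))"
    using has_pair_density_visible_pairs[OF rep w gcd] W unfolding assms(4) by simp
  ultimately show ?thesis using has_prod_euler_product[OF W] by blast
qed

end
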